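(* Every $1$-saturated subcubic graph $G$ such that $g_3(G)\le 4$ is $(1,2,2,2)$-packing colorable.
   Context: All graphs are finite, simple and undirected. For a non-decreasing sequence $S=(s_1,\dots,s_k)$ of positive integers, an $S$-packing coloring of $G$ is a partition of $V(G)$ into sets $V_1,\dots,V_k$ such that any two distinct vertices $u,v\in V_i$ satisfy $dist_G(u,v)>s_i$; $G$ is $S$-packing colorable if it admits one. $G$ is subcubic if its maximum degree is at most $3$. A subcubic graph is $k$-saturated if every vertex of degree $3$ is adjacent to at most $k$ vertices of degree $3$. The local girth $g(v)$ of a vertex $v$ is the length of a shortest cycle containing $v$ ($\infty$ if none), and $g_3(G)=\max\{g(v): d_G(v)=3\}$. *)

theory Defs
  imports
    "Graph_Theory.Graph_Theory"
    "HOL-Library.Extended_Nat"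
    "HOL-Library.Disjoint_Sets"
begin

text \<open>
  A finite simple undirected graph is a \<^const>\<open>pair_graph\<close>: a finite loop-free digraph
  without parallel arcs in which each edge \<open>uv\<close> is represented by the two arcs
  \<open>(u, v)\<close> and \<open>(v, u)\<close>. Hence the degree of a vertex is its out-degree.
\<close>

abbreviation degree :: "'a pair_pre_digraph \<Rightarrow> 'a \<Rightarrow> nat" where
  "degree G v \<equiv> out_degree (with_proj G) v"

definition subcubic :: "'a pair_pre_digraph \<Rightarrow> bool" where
  "subcubic G \<longleftrightarrow> (\<forall>v\<in>pverts G. degree G v \<le> 3)"

definition saturated :: "nat \<Rightarrow> 'a pair_pre_digraph \<Rightarrow> bool" where
  "saturated k G \<longleftrightarrow>
     (\<forall>v\<in>pverts G. degree G v = 3 \<longrightarrow> card {w. (v, w) \<in> parcs G \<and> degree G w = 3} \<le> k)"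

text \<open>The number of edges on a shortest walk, and \<open>\<infinity>\<close> between different components.\<close>

definition gdist :: "'a pair_pre_digraph \<Rightarrow> 'a \<Rightarrow> 'a \<Rightarrow> ereal" where
  "gdist G u v = wf_digraph.\<mu> (with_proj G) (\<lambda>_. 1) u v"

text \<open>
  The library's \<^const>\<open>pre_digraph.cycle\<close> also accepts the closed walk \<open>(u, v), (v, u)\<close>
  along a single edge; the length bound excludes it. The infimum of the empty set is \<open>\<infinity>\<close>.
\<close>

definition local_girth :: "'a pair_pre_digraph \<Rightarrow> 'a \<Rightarrow> enat" where
  "local_girth G v =
     (INF p \<in> {p. pre_digraph.cycle (with_proj G) p \<and> 3 \<le> length p \<and> v \<in> fst ` set p}.
        enat (length p))"

text \<open>
  The supremum is a maximum because the graph is finite; it is \<open>0\<close> if there is no vertex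
  of degree 3.
\<close>

definition g3 :: "'a pair_pre_digraph \<Rightarrow> enat" where
  "g3 G = (SUP v \<in> {v \<in> pverts G. degree G v = 3}. local_girth G v)"

text \<open>
  \<open>S\<close> is meant to be a non-decreasing list of positive integers. The classes are indexed from
  \<open>0\<close>, and as usual for colorings a class may be empty.
\<close>

definition packing_coloring :: "'a pair_pre_digraph \<Rightarrow> nat list \<Rightarrow> (nat \<Rightarrow> 'a set) \<Rightarrow> bool" where
  "packing_coloring G S V \<longleftrightarrow>
     (\<Union>i<length S. V i) = pverts G \<and>
     disjoint_family_on V {..<length S} \<and>
     (\<forall>i<length S. \<forall>u\<in>V i. \<forall>v\<in>V i. u \<noteq> v \<longrightarrow> gdist G u v > ereal (real (S ! i)))"

definition packing_colorable :: "'a pair_pre_digraph \<Rightarrow> nat list \<Rightarrow> bool" where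
  "packing_colorable G S \<longleftrightarrow> (\<exists>V. packing_coloring G S V)"

end

theory Submission
  imports Defs
begin

text \<open>
  Let \<open>J\<close> be an independent set of vertices of degree at most 2 of maximum size, and extend it
  to a maximal independent set \<open>I\<close>, the colour class of radius 1. Call two vertices outside \<open>I\<close>
  in conflict if their distance is at most 2. The conflict graph is 2-degenerate, so three
  colours suffice for it greedily.

  For the degeneracy, assume that every vertex of \<open>S\<close> has at least 3 conflicts inside \<open>S\<close>.
  Saturation and local girth at most 4 leave few shapes for the short cycle at a vertex of degree
  3: a pendant triangle, a square whose neighbours of that vertex have degree 2, or a triangle or
  square with exactly two vertices of degree 3, which are adjacent. In each of them the choice of
  \<open>I\<close> keeps the vertices of degree 3 out of \<open>S\<close>, and then the remaining vertices have too few
  conflicts. Maximum size of \<open>J\<close>, rather than maximality, is needed where one vertex of \<open>J\<close> could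
  be exchanged for its two neighbours.
\<close>

section \<open>Greedy colouring of degenerate relations\<close>

text \<open>Take out a vertex with at most \<open>d\<close> related vertices and colour the rest by
  induction; these block at most \<open>d\<close> of the \<open>d + 1\<close> colours in
  \<open>{..d}\<close>.\<close>

lemma degenerate_colorable:
  fixes R :: "'a \<Rightarrow> 'a \<Rightarrow> bool"
  assumes "finite W"
    and "\<And>u v. R u v \<Longrightarrow> R v u"
    and "\<And>S. S \<subseteq> W \<Longrightarrow> S \<noteq> {} \<Longrightarrow> \<exists>u\<in>S. card {w \<in> S. R u w} \<le> d"
  shows "\<exists>c :: 'a \<Rightarrow> nat. (\<forall>u\<in>W. c u \<le> d) \<and> (\<forall>u\<in>W. \<forall>v\<in>W. u \<noteq> v \<longrightarrow> R u v \<longrightarrow> c u \<noteq> c v)"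
  using assms(1,3)
proof (induction "card W" arbitrary: W)
  case 0
  then show ?case by simp
next
  case (Suc n)
  then obtain u where u: "u \<in> W" "card {w \<in> W. R u w} \<le> d"
    by (metis card.empty nat.distinct(1) order_refl)
  have "\<exists>c :: 'a \<Rightarrow> nat. (\<forall>u\<in>W - {u}. c u \<le> d) \<and>
      (\<forall>v\<in>W - {u}. \<forall>w\<in>W - {u}. v \<noteq> w \<longrightarrow> R v w \<longrightarrow> c v \<noteq> c w)"
  proof (rule Suc.hyps(1))
    show "n = card (W - {u})" using Suc.hyps(2) u(1) Suc.prems(1) by simp
    show "finite (W - {u})" using Suc.prems(1) by simp
    fix S assume "S \<subseteq> W - {u}" "S \<noteq> {}"
    then show "\<exists>u\<in>S. card {w \<in> S. R u w} \<le> d" using Suc.prems(2)[of S] by blast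
  qed
  then obtain c :: "'a \<Rightarrow> nat" where c: "\<forall>v\<in>W - {u}. c v \<le> d"
    "\<forall>v\<in>W - {u}. \<forall>w\<in>W - {u}. v \<noteq> w \<longrightarrow> R v w \<longrightarrow> c v \<noteq> c w" by blast
  have fin: "finite {w \<in> W. R u w}" using Suc.prems(1) by simp
  have "card (c ` {w \<in> W. R u w}) \<le> d" using card_image_le[OF fin, of c] u(2) by linarith
  then have "card (c ` {w \<in> W. R u w}) < card {..d}" by simp
  then have "\<not> {..d} \<subseteq> c ` {w \<in> W. R u w}"
    using card_mono[of "c ` {w \<in> W. R u w}" "{..d}"] fin by auto
  then obtain k where k: "k \<le> d" "k \<notin> c ` {w \<in> W. R u w}" by auto
  show ?case
  proof (intro exI conjI ballI impI)
    fix v assume "v \<in> W"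
    then show "(c(u := k)) v \<le> d" using c(1) k(1) by simp
  next
    fix v w assume vw: "v \<in> W" "w \<in> W" "v \<noteq> w" "R v w"
    then have "R w v" using assms(2) by blast
    then have "k \<noteq> c w" if "v = u" using k(2) vw that by blast
    moreover have "k \<noteq> c v" if "w = u" using k(2) vw that \<open>R w v\<close> by blast
    ultimately show "(c(u := k)) v \<noteq> (c(u := k)) w" using c(2) vw
      by (cases "v = u"; cases "w = u") auto
  qed
qed

section \<open>Local structure around vertices of degree 3\<close>

text \<open>By \<open>card_N\<close>, \<open>card (N v) \<noteq> 3\<close> says degree at most 2;
  such vertices are called low below, the others cubic. \<open>short_cycle\<close> unfolds local
  girth at most 4: a triangle \<open>v a b\<close> or a square \<open>v a w b\<close>.\<close>

locale short_cycle_graph =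
  fixes V :: "'a set" and N :: "'a \<Rightarrow> 'a set"
  assumes finite_V: "finite V"
    and N_sub: "N v \<subseteq> V"
    and N_sym: "w \<in> N v \<Longrightarrow> v \<in> N w"
    and N_irrefl: "v \<notin> N v"
    and card_N: "card (N v) \<le> 3"
    and saturated: "card (N v) = 3 \<Longrightarrow> a \<in> N v \<Longrightarrow> b \<in> N v \<Longrightarrow>
      card (N a) = 3 \<Longrightarrow> card (N b) = 3 \<Longrightarrow> a = b"
    and short_cycle: "card (N v) = 3 \<Longrightarrow>
      \<exists>a b. a \<in> N v \<and> b \<in> N v \<and> a \<noteq> b \<and> (b \<in> N a \<or> (\<exists>w. w \<noteq> v \<and> w \<in> N a \<and> w \<in> N b))"
begin

lemma finite_N: "finite (N v)"
  using finite_V N_sub finite_subset by blast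

lemma N_eq_pair:
  assumes "card (N v) \<noteq> 3" "a \<in> N v" "b \<in> N v" "a \<noteq> b"
  shows "N v = {a, b}"
proof -
  have "card (N v) \<le> card {a, b}" using assms card_N[of v] by simp
  then show ?thesis using card_seteq[OF finite_N, of "{a, b}" v] assms by auto
qed

lemma N_eq_triple:
  assumes "card (N v) = 3" "a \<in> N v" "b \<in> N v" "a \<noteq> b"
  obtains x where "N v = {a, b, x}" "x \<noteq> a" "x \<noteq> b"
proof -
  have "card (N v - {a, b}) = 1" using assms finite_N by (simp add: card_Diff_subset)
  then obtain x where "N v - {a, b} = {x}" by (auto simp: card_1_singleton_iff)
  then show ?thesis using that[of x] assms by blast
qed

text \<open>The edge \<open>v a\<close> joins the two cubic vertices and \<open>b\<close> is the low
  apex. The outer neighbours \<open>x\<close> and \<open>y\<close> may coincide.\<close>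

definition triangle :: "'a \<Rightarrow> 'a \<Rightarrow> 'a \<Rightarrow> 'a \<Rightarrow> 'a \<Rightarrow> bool" where
  "triangle v a b x y \<longleftrightarrow> N v = {b, a, x} \<and> N a = {b, v, y} \<and> N b = {v, a} \<and>
     card (N v) = 3 \<and> card (N a) = 3 \<and> card (N b) \<noteq> 3 \<and> card (N x) \<noteq> 3 \<and> card (N y) \<noteq> 3"

text \<open>The cycle is \<open>v b w a\<close>, with adjacent cubic vertices \<open>v\<close> and
  \<open>a\<close>. Again \<open>x = y\<close> is possible.\<close>

definition square :: "'a \<Rightarrow> 'a \<Rightarrow> 'a \<Rightarrow> 'a \<Rightarrow> 'a \<Rightarrow> 'a \<Rightarrow> bool" where
  "square v a b w x y \<longleftrightarrow> N v = {b, a, x} \<and> N a = {w, v, y} \<and> N b = {v, w} \<and> N w = {a, b} \<and>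
     card (N v) = 3 \<and> card (N a) = 3 \<and> card (N b) \<noteq> 3 \<and> card (N w) \<noteq> 3 \<and>
     card (N x) \<noteq> 3 \<and> card (N y) \<noteq> 3"

lemma triangle_sym: "triangle v a b x y \<Longrightarrow> triangle a v b y x"
  unfolding triangle_def by auto

lemma square_sym: "square v a b w x y \<Longrightarrow> square a v w b y x"
  unfolding square_def by auto

lemma triangleI:
  assumes "card (N v) = 3" "card (N a) = 3" "a \<in> N v" "b \<in> N v" "b \<in> N a"
  obtains x y where "triangle v a b x y"
proof -
  have ne: "a \<noteq> b" "v \<noteq> b" "v \<noteq> a" using assms N_irrefl by blast+
  have sym: "v \<in> N a" "v \<in> N b" "a \<in> N b" using assms N_sym by blast+
  have b: "card (N b) \<noteq> 3" using saturated[of v a b] assms ne by blast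
  obtain x where x: "N v = {b, a, x}" "x \<noteq> b" "x \<noteq> a"
    using N_eq_triple[of v b a] assms ne by metis
  obtain y where y: "N a = {b, v, y}" "y \<noteq> b" "y \<noteq> v"
    using N_eq_triple[of a b v] assms ne sym by metis
  have "card (N x) \<noteq> 3" using saturated[of v a x] assms x by auto
  moreover have "card (N y) \<noteq> 3" using saturated[of a v y] assms y by auto
  moreover have "N b = {v, a}" using N_eq_pair[OF b] sym ne by blast
  ultimately show ?thesis using that x y assms b unfolding triangle_def by blast
qed

lemma squareI:
  assumes "card (N v) = 3" "card (N a) = 3" "a \<in> N v" "b \<in> N v" "a \<noteq> b" "w \<noteq> v" "w \<in> N a" "w \<in> N b"
  obtains x y where "square v a b w x y"
proof -
  have ne: "v \<noteq> b" "v \<noteq> a" "w \<noteq> a" "w \<noteq> b" using assms N_irrefl by blast+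
  have sym: "v \<in> N a" "v \<in> N b" "a \<in> N w" "b \<in> N w" using assms N_sym by blast+
  have b: "card (N b) \<noteq> 3" using saturated[of v a b] assms ne by blast
  have w: "card (N w) \<noteq> 3" using saturated[of a v w] assms ne sym by blast
  obtain x where x: "N v = {b, a, x}" "x \<noteq> b" "x \<noteq> a"
    using N_eq_triple[of v b a] assms ne by metis
  obtain y where y: "N a = {w, v, y}" "y \<noteq> w" "y \<noteq> v"
    using N_eq_triple[of a w v] assms ne sym by metis
  have "card (N x) \<noteq> 3" using saturated[of v a x] assms x by auto
  moreover have "card (N y) \<noteq> 3" using saturated[of a v y] assms y by auto
  moreover have "N b = {v, w}" using N_eq_pair[OF b] sym assms by blast
  moreover have "N w = {a, b}" using N_eq_pair[OF w] sym assms by blast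
  ultimately show ?thesis using that x y assms b w unfolding square_def by blast
qed

text \<open>By saturation at most one of the two neighbours of \<open>v\<close> on the short cycle
  is cubic; whether one is, and the length of the cycle, give the four shapes.\<close>

lemma cubic_cases:
  assumes v: "card (N v) = 3"
  obtains
    (Pendant_triangle) a b x where "N v = {a, b, x}" "N a = {v, b}" "N b = {v, a}" "x \<noteq> a" "x \<noteq> b"
      "card (N a) \<noteq> 3" "card (N b) \<noteq> 3"
  | (Even_square) a b x w where "N v = {a, b, x}" "N a = {v, w}" "N b = {v, w}" "x \<noteq> a" "x \<noteq> b"
      "a \<noteq> b" "w \<noteq> v" "w \<noteq> x" "card (N a) \<noteq> 3" "card (N b) \<noteq> 3"
  | (Triangle) a b x y where "triangle v a b x y"
  | (Square) a b w x y where "square v a b w x y"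
proof -
  obtain a b where ab: "a \<in> N v" "b \<in> N v" "a \<noteq> b"
    and cyc: "b \<in> N a \<or> (\<exists>w. w \<noteq> v \<and> w \<in> N a \<and> w \<in> N b)" using short_cycle[OF v] by blast
  have sym: "v \<in> N a" "v \<in> N b" using ab N_sym by blast+
  have ne: "v \<noteq> a" "v \<noteq> b" using ab N_irrefl by blast+
  obtain x where x: "N v = {a, b, x}" "x \<noteq> a" "x \<noteq> b" using N_eq_triple[OF v ab] by metis
  from cyc show ?thesis
  proof
    assume t: "b \<in> N a"
    then have t': "a \<in> N b" using N_sym by blast
    show ?thesis
    proof (cases "card (N a) = 3")
      case True
      then show ?thesis using triangleI[of v a b] v ab t Triangle by metis
    next
      case a: False
      show ?thesis
      proof (cases "card (N b) = 3")
        case True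
        then show ?thesis using triangleI[of v b a] v ab t' Triangle by metis
      next
        case False
        then show ?thesis
          using Pendant_triangle[of a b x] x a N_eq_pair[OF a, of v b] N_eq_pair[OF False, of v a] sym ne t t'
          by blast
      qed
    qed
  next
    assume "\<exists>w. w \<noteq> v \<and> w \<in> N a \<and> w \<in> N b"
    then obtain w where w: "w \<noteq> v" "w \<in> N a" "w \<in> N b" by blast
    show ?thesis
    proof (cases "card (N a) = 3")
      case True
      then show ?thesis using squareI[of v a b w] v ab w Square by metis
    next
      case a: False
      show ?thesis
      proof (cases "card (N b) = 3")
        case True
        then show ?thesis using squareI[of v b a w] v ab w Square by metis
      next
        case b: False
        have N: "N a = {v, w}" "N b = {v, w}"
          using N_eq_pair[OF a, of v w] N_eq_pair[OF b, of v w] sym w by blast+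
        show ?thesis
        proof (cases "w = x")
          case False
          then show ?thesis using Even_square[OF x(1) N] x ab w a b by blast
        next
          case True
          \<comment> \<open>Here \<open>x\<close> is adjacent to \<open>v\<close>, \<open>a\<close>
            and \<open>b\<close>, hence cubic, so \<open>v x b\<close> is a triangle with two cubic
            vertices.\<close>
          have "{v, a, b} \<subseteq> N x" using True x N_sym w by blast
          moreover have "card {v, a, b} = 3" using ne ab by simp
          ultimately have "card (N x) = 3"
            using card_mono[OF finite_N, of "{v, a, b}" x] card_N[of x] by simp
          moreover have "x \<in> N v" "b \<in> N x" using x \<open>{v, a, b} \<subseteq> N x\<close> by auto
          ultimately show ?thesis using triangleI[of v x b] v ab Triangle by metis
        qed
      qed
    qed
  qed
qed

end

section \<open>The radius-1 class and hypothetical dense sets of conflicts\<close>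

text \<open>\<open>I_no_exchange\<close> is the only trace of maximum size: otherwise replacing
  \<open>z\<close> by \<open>p\<close> and \<open>q\<close> would give a larger independent set of
  low vertices.\<close>

locale low_maximum_set = short_cycle_graph +
  fixes I :: "'a set"
  assumes I_indep: "u \<in> I \<Longrightarrow> w \<in> N u \<Longrightarrow> w \<notin> I"
    and I_maximal: "u \<in> V \<Longrightarrow> u \<notin> I \<Longrightarrow> \<exists>z\<in>N u. z \<in> I"
    and I_maximal_low: "u \<in> V \<Longrightarrow> u \<notin> I \<Longrightarrow> card (N u) \<noteq> 3 \<Longrightarrow> \<exists>z\<in>N u. z \<in> I \<and> card (N z) \<noteq> 3"
    and I_no_exchange: "z \<in> I \<Longrightarrow> card (N z) \<noteq> 3 \<Longrightarrow> p \<in> V - I \<Longrightarrow> q \<in> V - I \<Longrightarrow>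
      card (N p) \<noteq> 3 \<Longrightarrow> card (N q) \<noteq> 3 \<Longrightarrow> p \<noteq> q \<Longrightarrow> q \<notin> N p \<Longrightarrow>
      \<exists>t. t \<noteq> z \<and> t \<in> I \<and> card (N t) \<noteq> 3 \<and> (t \<in> N p \<or> t \<in> N q)"

locale dense_conflicts = low_maximum_set +
  fixes S :: "'a set"
  assumes S_sub: "S \<subseteq> V - I"
    and S_dense: "u \<in> S \<Longrightarrow> card (\<Union>n\<in>N u. (insert n (N n) - {u}) \<inter> S) \<ge> 3"
begin

text \<open>The conflicts of \<open>u\<close> that are witnessed by its neighbour \<open>n\<close>.\<close>

definition K :: "'a \<Rightarrow> 'a \<Rightarrow> 'a set" where
  "K u n = (insert n (N n) - {u}) \<inter> S"

lemma not_in_S: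
  assumes "(\<Union>n\<in>N u. K u n) \<subseteq> {p, q}"
  shows "u \<notin> S"
proof
  assume "u \<in> S"
  then have "3 \<le> card (\<Union>n\<in>N u. K u n)" using S_dense unfolding K_def by blast
  also have "\<dots> \<le> card {p, q}" using assms by (intro card_mono) auto
  also have "\<dots> \<le> 2" by (simp add: card_insert_if)
  finally show False by simp
qed

lemma K_low:
  assumes "u \<notin> I" "n \<in> N u" "card (N n) \<noteq> 3"
  obtains t where "K u n \<subseteq> {t}"
proof -
  have u: "u \<in> N n" using assms N_sym by blast
  have "\<exists>t. K u n \<subseteq> {t}"
  proof (cases "N n = {u}")
    case True
    then show ?thesis unfolding K_def by blast
  next
    case False
    show ?thesis
    proof (cases "n \<in> I")
      case True
      obtain t where "t \<in> N n" "t \<noteq> u" using False u by blast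
      then have "N n = {u, t}" using N_eq_pair assms u by blast
      then show ?thesis using True S_sub unfolding K_def by blast
    next
      case F: False
      have "n \<in> V" using assms N_sub by blast
      then obtain z where "z \<in> N n" "z \<in> I" using I_maximal F by blast
      then have "N n = {u, z}" using N_eq_pair assms u by blast
      then show ?thesis using \<open>z \<in> I\<close> S_sub unfolding K_def by blast
    qed
  qed
  then show ?thesis using that by blast
qed

text \<open>Vertices leave \<open>S\<close> one after another: each exclusion shortens the conflict
  lists of the others until one of them fits into a pair. The outer neighbours are low and so
  witness at most one conflict each.\<close>

lemma square_not_in_S_aux:
  assumes sq: "square v a b w x y" and b: "b \<in> I"
  shows "v \<notin> S \<and> a \<notin> S \<and> b \<notin> S \<and> w \<notin> S"
proof -
  have N: "N v = {b, a, x}" "N a = {w, v, y}" "N b = {v, w}" "N w = {a, b}"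
    and c: "card (N x) \<noteq> 3" "card (N y) \<noteq> 3" using sq unfolding square_def by auto
  have v: "v \<notin> I" and w: "w \<notin> I" using I_indep[OF b] N by auto
  have IS: "\<And>t. t \<in> I \<Longrightarrow> t \<notin> S" using S_sub by blast
  obtain t where t: "K v x \<subseteq> {t}" using K_low[OF v, of x] N c by blast
  have bS: "b \<notin> S" using IS b by blast
  show ?thesis
  proof (cases "a \<in> I")
    case True
    then have aS: "a \<notin> S" using IS by blast
    have wS: "w \<notin> S" by (rule not_in_S[of w v y]) (use N aS bS in \<open>auto simp: K_def\<close>)
    have "v \<notin> S" by (rule not_in_S[of v y t]) (use N aS bS wS t in \<open>auto simp: K_def\<close>)
    then show ?thesis using aS bS wS by blast
  next
    case False
    have "a \<in> V" using N N_sub[of v] by blast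
    then have "y \<in> I" using I_maximal[OF _ False] N v w by auto
    then have yS: "y \<notin> S" using IS by blast
    obtain s where s: "K a y \<subseteq> {s}" using K_low[OF False, of y] N c by blast
    have wS: "w \<notin> S" by (rule not_in_S[of w v a]) (use N bS yS in \<open>auto simp: K_def\<close>)
    have vS: "v \<notin> S" by (rule not_in_S[of v a t]) (use N bS wS yS t in \<open>auto simp: K_def\<close>)
    have "a \<notin> S" by (rule not_in_S[of a x s]) (use N bS wS vS s in \<open>auto simp: K_def\<close>)
    then show ?thesis using bS vS wS by blast
  qed
qed

text \<open>One of the adjacent vertices \<open>b\<close> and \<open>w\<close> lies in
  \<open>I\<close>, because the other neighbour of each is cubic; the symmetry of the square covers
  both cases.\<close>

lemma square_not_in_S:
  assumes sq: "square v a b w x y"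
  shows "v \<notin> S \<and> a \<notin> S \<and> b \<notin> S \<and> w \<notin> S"
proof (cases "b \<in> I")
  case True
  then show ?thesis using square_not_in_S_aux sq by blast
next
  case False
  have "b \<in> V" using sq N_sub[of v] unfolding square_def by blast
  then have "w \<in> I" using I_maximal_low[OF _ False] sq unfolding square_def by auto
  then show ?thesis using square_not_in_S_aux[OF square_sym[OF sq]] by blast
qed

text \<open>
  Covers a pendant triangle at \<open>v\<close> and a square in which both neighbours of \<open>v\<close> have degree 2:
  seen from \<open>x\<close>, the vertex \<open>v\<close> adds at most \<open>v\<close> itself to the conflicts of \<open>x\<close>; seen
  from \<open>v\<close>, the whole rest of its short cycle adds at most one conflict.
\<close>

definition light :: "'a \<Rightarrow> 'a \<Rightarrow> bool" where
  "light v x \<longleftrightarrow> (\<exists>a b c. N v = {a, b, x} \<and> a \<notin> S \<and> b \<notin> S \<and> card (N a) \<noteq> 3 \<and> card (N b) \<noteq> 3 \<and>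
     x \<notin> N a \<and> x \<notin> N b \<and> K v a \<union> K v b \<subseteq> {c} \<and> v \<notin> I)"

lemma lightI:
  assumes "N v = {a, b, x}" "a \<notin> S" "b \<notin> S" "card (N a) \<noteq> 3" "card (N b) \<noteq> 3"
    "x \<notin> N a" "x \<notin> N b" "K v a \<union> K v b \<subseteq> {c}" "v \<notin> I"
  shows "light v x"
  unfolding light_def using assms by blast

text \<open>With \<open>a\<close> in \<open>I\<close>, only \<open>v\<close> and \<open>x\<close>
  can conflict with \<open>b\<close>, so \<open>b\<close> leaves \<open>S\<close> as well.\<close>

lemma light_pendant_triangle:
  assumes N: "N v = {a, b, x}" "N a = {v, b}" "N b = {v, a}" and x: "x \<noteq> a" "x \<noteq> b"
    and c: "card (N a) \<noteq> 3" "card (N b) \<noteq> 3" and a: "a \<in> I"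
  shows "light v x"
proof -
  have aS: "a \<notin> S" using a S_sub by blast
  have bS: "b \<notin> S" by (rule not_in_S[of b v x]) (use N aS in \<open>auto simp: K_def\<close>)
  have "x \<noteq> v" using N N_irrefl[of v] by auto
  moreover have "K v a \<union> K v b \<subseteq> {b}" using N aS unfolding K_def by auto
  moreover have "v \<notin> I" using I_indep[OF a] N by blast
  ultimately show ?thesis using N aS bS c x
    by (intro lightI[of v a b x b]) auto
qed

text \<open>The exchange property forces both \<open>a\<close> and \<open>b\<close> into
  \<open>I\<close>; from \<open>v\<close> only \<open>w\<close> is then seen across the
  square.\<close>

lemma light_even_square:
  assumes N: "N v = {a, b, x}" "N a = {v, w}" "N b = {v, w}" and x: "x \<noteq> a" "x \<noteq> b"
    and ne: "a \<noteq> b" "w \<noteq> v" "w \<noteq> x"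
    and c: "card (N a) \<noteq> 3" "card (N b) \<noteq> 3" and v: "card (N v) = 3"
  shows "light v x"
proof -
  have V: "a \<in> V" "b \<in> V" using N N_sub[of v] by blast+
  have w_ab: "w \<noteq> a" "w \<noteq> b" using N N_irrefl by blast+
  have xv: "x \<noteq> v" using N N_irrefl[of v] by auto
  have ab: "b \<notin> N a" using N N_irrefl[of b] w_ab by auto
  have ba: "a \<notin> N b" using N N_irrefl[of a] w_ab by auto
  have *: "a \<in> I \<and> b \<in> I"
  proof (rule ccontr)
    assume asm: "\<not> (a \<in> I \<and> b \<in> I)"
    \<comment> \<open>The one missing from \<open>I\<close> has a low neighbour in \<open>I\<close>,
      which cannot be the cubic \<open>v\<close>.\<close>
    then have w: "w \<in> I" "card (N w) \<noteq> 3"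
      using I_maximal_low[of a] I_maximal_low[of b] V c v N by auto
    have "w \<in> N a" "w \<in> N b" using N by auto
    then have "a \<in> N w" "b \<in> N w" using N_sym by blast+
    then have "a \<notin> I" "b \<notin> I" using I_indep[OF w(1)] by auto
    \<comment> \<open>Exchange \<open>w\<close> for \<open>a\<close> and \<open>b\<close>: their
      only other neighbour is \<open>v\<close>, which is cubic.\<close>
    then have "\<exists>t. t \<noteq> w \<and> t \<in> I \<and> card (N t) \<noteq> 3 \<and> (t \<in> N a \<or> t \<in> N b)"
      using I_no_exchange[OF w, of a b] V c ne ab by blast
    then show False using N v by auto
  qed
  then have S: "a \<notin> S" "b \<notin> S" using S_sub by blast+
  have "v \<notin> I" using I_indep[of a v] * N by blast
  moreover have "K v a \<union> K v b \<subseteq> {w}" using N S unfolding K_def by auto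
  ultimately show ?thesis using N S c x xv ne
    by (intro lightI[of v a b x w]) auto
qed

lemma cubic_cases_S:
  assumes v: "card (N v) = 3"
  obtains (Light) x where "light v x"
  | (Triangle) a b x y where "triangle v a b x y"
  | (Square) a b w x y where "square v a b w x y"
proof (rule cubic_cases[OF v])
  fix a b x
  assume N: "N v = {a, b, x}" "N a = {v, b}" "N b = {v, a}" and x: "x \<noteq> a" "x \<noteq> b"
    and c: "card (N a) \<noteq> 3" "card (N b) \<noteq> 3"
  show thesis
  proof (cases "a \<in> I")
    case True
    then show thesis using light_pendant_triangle[OF N x c] Light by blast
  next
    case False
    have "a \<in> V" using N N_sub[of v] by blast
    then have "b \<in> I" using I_maximal_low[OF _ False] c N v by auto
    moreover have "N v = {b, a, x}" using N by auto
    ultimately show thesis using light_pendant_triangle[of v b a x] N x c Light by blast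
  qed
next
  fix a b x w
  assume "N v = {a, b, x}" "N a = {v, w}" "N b = {v, w}" "x \<noteq> a" "x \<noteq> b"
    "a \<noteq> b" "w \<noteq> v" "w \<noteq> x" "card (N a) \<noteq> 3" "card (N b) \<noteq> 3"
  from light_even_square[OF this v] show thesis by (rule Light)
next
  fix a b x y
  assume "triangle v a b x y"
  then show thesis by (rule Triangle)
next
  fix a b w x y
  assume "square v a b w x y"
  then show thesis by (rule Square)
qed

text \<open>The short cycle adds at most one conflict, so it suffices that \<open>x\<close>
  witnesses at most one more. This is \<open>K_low\<close> for low \<open>x\<close>; for cubic
  \<open>x\<close> the shape at \<open>x\<close> decides.\<close>

lemma light_not_in_S:
  assumes l: "light v x" and v: "card (N v) = 3"
  shows "v \<notin> S"
proof -
  obtain a b c where N: "N v = {a, b, x}" and ab: "a \<notin> S" "b \<notin> S" "card (N a) \<noteq> 3" "card (N b) \<noteq> 3"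
    "x \<notin> N a" "x \<notin> N b" and K: "K v a \<union> K v b \<subseteq> {c}" and vI: "v \<notin> I"
    using l unfolding light_def by blast
  have xv: "x \<in> N v" "v \<in> N x" using N N_sym[of x v] by auto
  have *: "v \<notin> S" if "K v x \<subseteq> {t}" for t
    by (rule not_in_S[of v c t]) (use N K that in auto)
  show ?thesis
  proof (cases "card (N x) = 3")
    case False
    then show ?thesis using K_low[OF vI, of x] xv * by blast
  next
    case True
    then show ?thesis
    proof (cases rule: cubic_cases_S)
      case (Light x')
      then obtain a' b' where x': "N x = {a', b', x'}" "a' \<notin> S" "b' \<notin> S"
        "card (N a') \<noteq> 3" "card (N b') \<noteq> 3" unfolding light_def by blast
      \<comment> \<open>\<open>v\<close> is cubic while \<open>a'\<close> and \<open>b'\<close> are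
        low.\<close>
      then have "x' = v" using xv v by auto
      then have "K v x \<subseteq> {x}" using x' unfolding K_def by auto
      then show ?thesis by (rule *)
    next
      case (Triangle a' b' x' y')
      \<comment> \<open>By saturation the cubic neighbour of \<open>x\<close> in its triangle is
        \<open>v\<close>. The apex \<open>b'\<close> is then \<open>a\<close> or \<open>b\<close>,
        yet adjacent to \<open>x\<close>, contrary to lightness.\<close>
      then have "a' = v" using saturated[OF True, of a' v] xv v unfolding triangle_def by auto
      then have "N v = {b', x, y'}" "x \<in> N b'" "b' \<noteq> x"
        using Triangle True unfolding triangle_def by auto
      then show ?thesis using N ab by auto
    next
      case (Square a' b' w' x' y')
      then have "a' = v" using saturated[OF True, of a' v] xv v unfolding square_def by auto
      then show ?thesis using square_not_in_S Square by blast
    qed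
  qed
qed

text \<open>Both neighbours of the apex are cubic, so it has no low neighbour that could keep it out
  of \<open>I\<close>.\<close>

lemma triangle_apex_in_I:
  assumes "triangle v a b x y"
  shows "b \<in> I"
proof (rule ccontr)
  assume "b \<notin> I"
  moreover have "b \<in> V" using assms N_sub[of v] unfolding triangle_def by blast
  ultimately show False using I_maximal_low[of b] assms unfolding triangle_def by auto
qed

lemma triangle_not_in_S_aux:
  assumes tr: "triangle v a b x y" and x: "x \<in> I"
  shows "v \<notin> S \<and> a \<notin> S"
proof -
  have N: "N v = {b, a, x}" "N a = {b, v, y}" "N b = {v, a}"
    and c: "card (N x) \<noteq> 3" "card (N y) \<noteq> 3" using tr unfolding triangle_def by auto
  have b: "b \<in> I" using triangle_apex_in_I[OF tr] .
  have I: "v \<notin> I" "a \<notin> I" using I_indep[OF b] N by auto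
  have S: "b \<notin> S" "x \<notin> S" using b x S_sub by blast+
  obtain t where t: "K v x \<subseteq> {t}" using K_low[OF I(1), of x] N c by blast
  obtain s where s: "K a y \<subseteq> {s}" using K_low[OF I(2), of y] N c by blast
  have aS: "a \<notin> S" by (rule not_in_S[of a v s]) (use N S s in \<open>auto simp: K_def\<close>)
  have "v \<notin> S" by (rule not_in_S[of v y t]) (use N S aS t in \<open>auto simp: K_def\<close>)
  then show ?thesis using aS by blast
qed

text \<open>Low neighbours witness at most one conflict each, so three conflicts require a second,
  cubic neighbour next to the low one in \<open>I\<close>.\<close>

lemma low_in_S:
  assumes u: "u \<in> S" "card (N u) \<noteq> 3"
  obtains z n where "N u = {z, n}" "z \<in> I" "card (N z) \<noteq> 3" "card (N n) = 3"
proof -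
  have uV: "u \<in> V" "u \<notin> I" using u S_sub by blast+
  obtain z where z: "z \<in> N u" "z \<in> I" "card (N z) \<noteq> 3" using I_maximal_low uV u by blast
  obtain t where t: "K u z \<subseteq> {t}" using K_low[OF uV(2)] z by blast
  have "N u \<noteq> {z}" using not_in_S[of u t t] t u by auto
  then obtain n where n: "n \<in> N u" "n \<noteq> z" using z by blast
  then have N: "N u = {z, n}" using N_eq_pair[OF u(2)] z by blast
  have "card (N n) = 3"
  proof (rule ccontr)
    assume "card (N n) \<noteq> 3"
    then obtain s where "K u n \<subseteq> {s}" using K_low[OF uV(2)] n by blast
    then show False using not_in_S[of u t s] t u N by auto
  qed
  then show ?thesis using that N z by blast
qed

section \<open>Triangles with two vertices of degree 3, and the end of the degeneracy
  argument\<close>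

lemma triangle_not_in_S:
  assumes tr: "triangle v a b x y"
  shows "v \<notin> S \<and> a \<notin> S"
proof (cases "x \<in> I \<or> y \<in> I")
  case True
  then show ?thesis
    using triangle_not_in_S_aux[OF tr] triangle_not_in_S_aux[OF triangle_sym[OF tr]] by blast
next
  case False
  have N: "N v = {b, a, x}" "N a = {b, v, y}" "N b = {v, a}"
    and c: "card (N x) \<noteq> 3" "card (N y) \<noteq> 3" "card (N v) = 3" "card (N a) = 3"
    using tr unfolding triangle_def by auto
  have b: "b \<in> I" using triangle_apex_in_I[OF tr] .
  have I: "v \<notin> I" "a \<notin> I" using I_indep[OF b] N by auto
  have bS: "b \<notin> S" using b S_sub by blast
  have VV: "x \<in> V" "y \<in> V" using N N_sub[of v] N_sub[of a] by blast+
  \<comment> \<open>Sharpens \<open>K_low\<close> by naming the conflict: the neighbour of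
    \<open>n\<close> other than \<open>p\<close> is in \<open>I\<close>.\<close>
  have K_end: "K p n \<subseteq> {n}" if pn: "n \<in> N p" "p \<notin> I" "n \<in> V" "n \<notin> I" "card (N n) \<noteq> 3" for p n
  proof -
    obtain z where "z \<in> N n" "z \<in> I" using I_maximal[OF pn(3,4)] by blast
    moreover have "p \<in> N n" using N_sym pn by blast
    ultimately have "N n = {p, z}" using N_eq_pair[OF pn(5)] pn by blast
    then show ?thesis using \<open>z \<in> I\<close> S_sub unfolding K_def by blast
  qed
  have Kx: "K v x \<subseteq> {x}" and Ky: "K a y \<subseteq> {y}" using K_end[of x v] K_end[of y a] N c I VV False by auto
  have xS: "x \<notin> S"
  proof
    assume x: "x \<in> S"
    obtain z n where zn: "N x = {z, n}" "z \<in> I" "card (N z) \<noteq> 3" "card (N n) = 3"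
      using low_in_S[OF x c(1)] by blast
    have "v \<in> N x" using N N_sym[of x v] by blast
    then have Nx: "N x = {z, v}" using zn c I by auto
    have Kv: "K x v \<subseteq> {v, a}" using N bS unfolding K_def by auto
    have "x \<in> N z" using zn N_sym[of z x] by blast
    \<comment> \<open>Through \<open>v\<close> there are at most the conflicts \<open>v\<close> and
      \<open>a\<close>, so a third one must come through \<open>z\<close>.\<close>
    have "\<exists>q. q \<in> N z \<and> q \<noteq> x \<and> q \<in> S"
    proof (rule ccontr)
      assume "\<not> ?thesis"
      then have "K x z \<subseteq> {}" using zn S_sub unfolding K_def by blast
      then show False using not_in_S[of x v a] Nx Kv x by auto
    qed
    then obtain q where q: "q \<in> N z" "q \<noteq> x" "q \<in> S" by blast
    have zq: "z \<in> N q" using q N_sym by blast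
    show False
    proof (cases "card (N q) = 3")
      case True
      then show False
      proof (cases rule: cubic_cases_S)
        case (Light x')
        then show False using light_not_in_S True q by blast
      next
        case (Square a' b' w' x' y')
        then show False using square_not_in_S q by blast
      next
        case (Triangle a' b' x' y')
        then have N': "N q = {b', a', x'}" "N b' = {q, a'}" "card (N a') = 3" unfolding triangle_def by auto
        have "b' \<noteq> z"
        proof
          assume "b' = z"
          then have "x = a'" using \<open>x \<in> N z\<close> N' q by auto
          then show False using N' c by blast
        qed
        \<comment> \<open>The low vertex \<open>z\<close> is not \<open>a'\<close>, so it is the
          outer neighbour of \<open>q\<close>; as \<open>z\<close> is in \<open>I\<close>, the
          settled case of triangles applies to \<open>q\<close>.\<close>
        then have "x' = z" using zq N' zn by auto
        then show False using triangle_not_in_S_aux[OF Triangle] zn q by blast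
      qed
    next
      case False
      obtain z' n' where z': "N q = {z', n'}" "z' \<in> I" "card (N z') \<noteq> 3" "card (N n') = 3"
        using low_in_S[OF q(3) False] by blast
      have "z' = z" using zq z' zn by auto
      have "q \<noteq> z" using q N_irrefl by blast
      then have "q \<notin> N x" using Nx False c by auto
      \<comment> \<open>Apart from \<open>z\<close>, both \<open>x\<close> and \<open>q\<close> have
        only a cubic neighbour, so \<open>z\<close> could be exchanged for them.\<close>
      then have "\<exists>t. t \<noteq> z \<and> t \<in> I \<and> card (N t) \<noteq> 3 \<and> (t \<in> N x \<or> t \<in> N q)"
        using I_no_exchange[OF zn(2,3), of x q] x q S_sub False c by blast
      then show False using Nx z' \<open>z' = z\<close> c by auto
    qed
  qed
  have vS: "v \<notin> S" by (rule not_in_S[of v a y]) (use N bS xS Kx in \<open>auto simp: K_def\<close>)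
  have "a \<notin> S" by (rule not_in_S[of a v y]) (use N bS xS vS Ky in \<open>auto simp: K_def\<close>)
  then show ?thesis using vS by blast
qed

text \<open>All cubic vertices are outside \<open>S\<close>. A low \<open>u\<close> in
  \<open>S\<close> would get no conflict from its cubic neighbour, whose other neighbours are
  outside \<open>S\<close> too, and at most one from its low neighbour.\<close>

lemma S_empty: "S = {}"
proof (rule ccontr)
  assume "S \<noteq> {}"
  then obtain u where u: "u \<in> S" by blast
  have uI: "u \<notin> I" using u S_sub by blast
  have cubic: "v \<notin> S" if "card (N v) = 3" for v
    using that
    by (cases rule: cubic_cases_S) (use light_not_in_S that triangle_not_in_S square_not_in_S in \<open>blast+\<close>)
  then have "card (N u) \<noteq> 3" using u by blast
  then obtain z n where zn: "N u = {z, n}" "z \<in> I" "card (N z) \<noteq> 3" "card (N n) = 3"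
    using low_in_S u by blast
  obtain t where t: "K u z \<subseteq> {t}" using K_low[OF uI] zn by blast
  have un: "u \<in> N n" using zn N_sym[of n u] by blast
  have nS: "n \<notin> S" using cubic zn by blast
  from zn(4) have "K u n = {}"
  proof (cases rule: cubic_cases_S)
    case (Light x)
    then obtain a b where "N n = {a, b, x}" "a \<notin> S" "b \<notin> S" unfolding light_def by blast
    then show ?thesis using u un nS unfolding K_def by auto
  next
    case (Triangle a b x y)
    then have "N n = {b, a, x}" "b \<notin> S" "a \<notin> S"
      using triangle_apex_in_I[OF Triangle] triangle_not_in_S[OF Triangle] S_sub
      unfolding triangle_def by auto
    then show ?thesis using u un nS unfolding K_def by auto
  next
    case (Square a b w x y)
    then have "N n = {b, a, x}" "b \<notin> S" "a \<notin> S"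
      using square_not_in_S[OF Square] unfolding square_def by auto
    then show ?thesis using u un nS unfolding K_def by auto
  qed
  then show False using not_in_S[of u t t] t u zn by auto
qed

end

section \<open>Existence of the radius-1 class and the four-colouring\<close>

context short_cycle_graph
begin

text \<open>Choose \<open>J\<close> of maximum size among independent sets of low vertices, then
  \<open>I\<close> of maximum size among independent sets containing \<open>J\<close>.\<close>

lemma ex_low_maximum_set: "\<exists>I. low_maximum_set V N I"
proof -
  define D where "D = {v \<in> V. card (N v) \<noteq> 3}"
  define indep where "indep A \<longleftrightarrow> (\<forall>u\<in>A. \<forall>w\<in>N u. w \<notin> A)" for A
  define P where "P A \<longleftrightarrow> A \<subseteq> D \<and> indep A" for A
  have DV: "D \<subseteq> V" unfolding D_def by blast
  have finD: "finite A" if "A \<subseteq> V" for A using that finite_V finite_subset by blast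
  have bnd: "card A < Suc (card V)" if "A \<subseteq> V" for A using card_mono[OF finite_V that] by simp
  have bndP: "\<forall>A. P A \<longrightarrow> card A < Suc (card V)" using bnd DV unfolding P_def by blast
  have indep_insert: "indep (insert u A)" if "indep A" "\<forall>z\<in>N u. z \<notin> A" for u A
    using that N_sym N_irrefl unfolding indep_def by blast
  have "P {}" unfolding P_def indep_def by simp
  then obtain J where J: "P J" "\<And>A. P A \<Longrightarrow> card A \<le> card J"
    using ex_has_greatest_nat[of P "{}" card "Suc (card V)"] bndP by blast
  define Q where "Q A \<longleftrightarrow> A \<subseteq> V \<and> J \<subseteq> A \<and> indep A" for A
  have bndQ: "\<forall>A. Q A \<longrightarrow> card A < Suc (card V)" using bnd unfolding Q_def by blast
  have "Q J" using J DV unfolding Q_def P_def by blast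
  then obtain I where I: "Q I" "\<And>A. Q A \<Longrightarrow> card A \<le> card I"
    using ex_has_greatest_nat[of Q J card "Suc (card V)"] bndQ by blast
  have finI: "finite I" and finJ: "finite J" using I J finD DV unfolding Q_def P_def by blast+
  have lowJ: "\<exists>z\<in>N u. z \<in> J" if "u \<in> D" "u \<notin> J" for u
  proof (rule ccontr)
    assume "\<not> ?thesis"
    then have "P (insert u J)" using J(1) that indep_insert[of J u] unfolding P_def by blast
    then show False using J(2)[of "insert u J"] finJ that by simp
  qed
  \<comment> \<open>A low vertex outside \<open>J\<close> has a neighbour in \<open>J\<close>, so
    passing from \<open>J\<close> to \<open>I\<close> adds only cubic vertices.\<close>
  have ID: "I \<inter> D = J"
    using lowJ I(1) J(1) unfolding Q_def P_def indep_def by blast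
  have "low_maximum_set V N I"
  proof
    show "w \<notin> I" if "u \<in> I" "w \<in> N u" for u w using I(1) that unfolding Q_def indep_def by blast
    show "\<exists>z\<in>N u. z \<in> I" if "u \<in> V" "u \<notin> I" for u
    proof (rule ccontr)
      assume "\<not> ?thesis"
      then have "Q (insert u I)" using I(1) that indep_insert[of I u] unfolding Q_def by blast
      then show False using I(2)[of "insert u I"] finI that by simp
    qed
    show "\<exists>z\<in>N u. z \<in> I \<and> card (N z) \<noteq> 3" if "u \<in> V" "u \<notin> I" "card (N u) \<noteq> 3" for u
      using lowJ[of u] that ID unfolding D_def by blast
    fix z p q
    assume z: "z \<in> I" "card (N z) \<noteq> 3" and pq: "p \<in> V - I" "q \<in> V - I"
      "card (N p) \<noteq> 3" "card (N q) \<noteq> 3" "p \<noteq> q" "q \<notin> N p"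
    show "\<exists>t. t \<noteq> z \<and> t \<in> I \<and> card (N t) \<noteq> 3 \<and> (t \<in> N p \<or> t \<in> N q)"
    proof (rule ccontr)
      assume no: "\<not> ?thesis"
      have J_I: "t \<in> I \<and> card (N t) \<noteq> 3" if "t \<in> J" for t using that ID unfolding D_def by blast
      have "indep (J - {z})" using J(1) unfolding P_def indep_def by blast
      then have "indep (insert q (J - {z}))" using no J_I by (intro indep_insert[of "J - {z}"]) blast+
      then have "indep (insert p (insert q (J - {z})))" using no J_I pq by (intro indep_insert[of "insert q (J - {z})"]) blast+
      \<comment> \<open>This set has one element more than \<open>J\<close>.\<close>
      then have "P (insert p (insert q (J - {z})))" using pq J(1) unfolding P_def D_def by blast
      then have "card (insert p (insert q (J - {z}))) \<le> card J" by (rule J(2))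
      moreover have "z \<in> J" using z ID I(1) unfolding D_def Q_def by blast
      moreover have "p \<notin> J" "q \<notin> J" using pq J_I by blast+
      ultimately show False using finJ pq card_Suc_Diff1[OF finJ, of z] by simp
    qed
  qed
  then show ?thesis by blast
qed

lemma ex_coloring:
  obtains c :: "'a \<Rightarrow> nat" where "\<And>v. c v < 4"
    "\<And>u v. u \<in> V \<Longrightarrow> v \<in> N u \<Longrightarrow> c u \<noteq> c v"
    "\<And>u v n. u \<in> V \<Longrightarrow> u \<noteq> v \<Longrightarrow> n \<in> N u \<Longrightarrow> v \<in> N n \<Longrightarrow> c u = c v \<Longrightarrow> c u = 0"
proof -
  obtain I where "low_maximum_set V N I" using ex_low_maximum_set by blast
  then interpret low_maximum_set V N I .
  define R where "R u w \<longleftrightarrow> w \<noteq> u \<and> (\<exists>n\<in>N u. w = n \<or> w \<in> N n)" for u w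
  have "\<exists>c :: 'a \<Rightarrow> nat. (\<forall>u\<in>V - I. c u \<le> 2) \<and>
      (\<forall>u\<in>V - I. \<forall>v\<in>V - I. u \<noteq> v \<longrightarrow> R u v \<longrightarrow> c u \<noteq> c v)"
  proof (rule degenerate_colorable)
    show "finite (V - I)" using finite_V by simp
    show "R v u" if "R u v" for u v using that N_sym unfolding R_def by blast
    fix S assume S: "S \<subseteq> V - I" "S \<noteq> {}"
    show "\<exists>u\<in>S. card {w \<in> S. R u w} \<le> 2"
    proof (rule ccontr)
      assume neg: "\<not> ?thesis"
      have eq: "(\<Union>n\<in>N u. (insert n (N n) - {u}) \<inter> S) = {w \<in> S. R u w}" for u
        unfolding R_def by blast
      have "3 \<le> card (\<Union>n\<in>N u. (insert n (N n) - {u}) \<inter> S)" if "u \<in> S" for u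
        using neg that unfolding eq by force
      then interpret dense_conflicts V N I S using S by unfold_locales
      show False using S_empty S by blast
    qed
  qed
  then obtain c :: "'a \<Rightarrow> nat" where c: "\<And>u. u \<in> V - I \<Longrightarrow> c u \<le> 2"
    "\<And>u v. u \<in> V - I \<Longrightarrow> v \<in> V - I \<Longrightarrow> u \<noteq> v \<Longrightarrow> R u v \<Longrightarrow> c u \<noteq> c v" by blast
  \<comment> \<open>The shift reserves colour 0 for \<open>I\<close>. Points outside
    \<open>V\<close> also get 0, harmlessly, as they are nobody's neighbours.\<close>
  define c' where "c' v = (if v \<in> V - I then Suc (c v) else 0)" for v
  have N_V: "v \<in> V" if "v \<in> N u" for u v using that N_sub by blast
  show ?thesis
  proof (rule that[of c'])
    show "c' v < 4" for v using c(1)[of v] unfolding c'_def by (simp add: less_Suc_eq_le[of _ 2, simplified])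
    show "c' u \<noteq> c' v" if "u \<in> V" "v \<in> N u" for u v
    proof -
      have "R u v" "u \<noteq> v" using that N_irrefl unfolding R_def by blast+
      then show ?thesis using that c(2)[of u v] I_indep[of u v] N_V[of v u] unfolding c'_def by auto
    qed
    show "c' u = 0" if "u \<in> V" "u \<noteq> v" "n \<in> N u" "v \<in> N n" "c' u = c' v" for u v n
    proof -
      have "R u v" using that unfolding R_def by blast
      then show ?thesis using that c(2)[of u v] N_V[of v n] unfolding c'_def by (auto split: if_splits)
    qed
  qed
qed

end

section \<open>Distances and short cycles in the graph library\<close>

context pair_graph
begin

lemma degree_eq_card: "degree G v = card {w. (v, w) \<in> parcs G}"
proof -
  have "out_arcs (with_proj G) v = Pair v ` {w. (v, w) \<in> parcs G}"
    unfolding out_arcs_def by auto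
  then show ?thesis unfolding out_degree_def by (simp add: card_image inj_on_def)
qed

lemma awalk_cost_one: "awalk_cost (\<lambda>_. 1) p = real (length p)"
  by (induction p) simp_all

text \<open>An infimum over walks gives only a non-strict bound; the strict bounds below come from
  using it with the next larger integer.\<close>

lemma gdist_geI:
  assumes "\<And>p. awalk u p v \<Longrightarrow> k \<le> length p"
  shows "ereal (real k) \<le> gdist G u v"
  unfolding gdist_def \<mu>_def
  by (rule INF_greatest) (use assms in \<open>simp add: awalk_cost_one\<close>)

lemma gdist_gt_1:
  assumes "u \<noteq> v" "(u, v) \<notin> parcs G"
  shows "gdist G u v > ereal 1"
proof -
  have "2 \<le> length p" if "awalk u p v" for p
    using that assms by (cases p; cases "tl p") (auto simp: awalk_Cons_iff awalk_Nil_iff)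
  then have "ereal (real 2) \<le> gdist G u v" by (rule gdist_geI)
  then show ?thesis by (rule less_le_trans[rotated]) simp
qed

lemma gdist_gt_2:
  assumes "u \<noteq> v" "(u, v) \<notin> parcs G" "\<And>n. (u, n) \<in> parcs G \<Longrightarrow> (n, v) \<notin> parcs G"
  shows "gdist G u v > ereal 2"
proof -
  have "3 \<le> length p" if "awalk u p v" for p
    using that assms
    by (cases p; cases "tl p"; cases "tl (tl p)") (auto simp: awalk_Cons_iff awalk_Nil_iff)
  then have "ereal (real 3) \<le> gdist G u v" by (rule gdist_geI)
  then show ?thesis by (rule less_le_trans[rotated]) simp
qed

text \<open>On a cycle of length 3 or 4 through \<open>v\<close>, take for \<open>a\<close> and
  \<open>b\<close> the two neighbours of \<open>v\<close> along it.\<close>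

lemma local_girth_le_4:
  assumes "local_girth G v \<le> 4"
  shows "\<exists>a b. (v, a) \<in> parcs G \<and> (v, b) \<in> parcs G \<and> a \<noteq> b \<and>
    ((a, b) \<in> parcs G \<or> (\<exists>w. w \<noteq> v \<and> (a, w) \<in> parcs G \<and> (b, w) \<in> parcs G))"
proof -
  let ?C = "{p. cycle p \<and> 3 \<le> length p \<and> v \<in> fst ` set p}"
  have sym: "(x, y) \<in> parcs G \<Longrightarrow> (y, x) \<in> parcs G" for x y
    using arcs_symmetric by blast
  \<comment> \<open>The strict form yields an actual cycle below the bound.\<close>
  have "(INF p\<in>?C. enat (length p)) < 5"
    using assms unfolding local_girth_def by (simp add: le_less_trans)
  then obtain p where p: "cycle p" "3 \<le> length p" "v \<in> fst ` set p" "enat (length p) < 5"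
    unfolding INF_less_iff by auto
  from p(4) have "length p < 5" by (simp add: numeral_eq_enat)
  with p(2) consider "length p = 3" | "length p = 4" by linarith
  then show ?thesis
  proof cases
    case 1
    then obtain e1 e2 e3 where "p = [e1, e2, e3]"
      by (auto simp: numeral_3_eq_3 length_Suc_conv)
    with p(1) obtain x y z where xyz: "p = [(x, y), (y, z), (z, x)]"
      "(x, y) \<in> parcs G" "(y, z) \<in> parcs G" "(z, x) \<in> parcs G" "x \<noteq> y" "y \<noteq> z" "z \<noteq> x"
      unfolding cycle_def by (cases e1; cases e2; cases e3) (auto simp: awalk_Cons_iff awalk_Nil_iff)
    then have "v = x \<or> v = y \<or> v = z" using p(3) by auto
    then show ?thesis using xyz sym by metis
  next
    case 2
    then obtain e1 e2 e3 e4 where "p = [e1, e2, e3, e4]"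
      by (auto simp: eval_nat_numeral length_Suc_conv)
    with p(1) obtain x y z w where xyz: "p = [(x, y), (y, z), (z, w), (w, x)]"
      "(x, y) \<in> parcs G" "(y, z) \<in> parcs G" "(z, w) \<in> parcs G" "(w, x) \<in> parcs G"
      "x \<noteq> z" "y \<noteq> w"
      unfolding cycle_def
      by (cases e1; cases e2; cases e3; cases e4) (auto simp: awalk_Cons_iff awalk_Nil_iff)
    then have "v = x \<or> v = y \<or> v = z \<or> v = w" using p(3) by auto
    then show ?thesis using xyz sym by metis
  qed
qed

end

section \<open>Transfer to the graph\<close>

theorem theorem2:
  fixes G :: "'a pair_pre_digraph"
  assumes "pair_graph G"
    and "subcubic G"
    and "saturated 1 G"
    and "g3 G \<le> 4"
  shows "packing_colorable G [1, 2, 2, 2]"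
proof -
  interpret pair_graph G by fact
  define N where "N v = {w. (v, w) \<in> parcs G}" for v
  have deg: "degree G v = card (N v)" for v unfolding N_def by (rule degree_eq_card)
  have N_sub: "N v \<subseteq> pverts G" for v unfolding N_def using in_arcsD2 by blast
  \<comment> \<open>The locale assumptions range over the whole type; elements that are not vertices
    satisfy them by having no neighbours.\<close>
  have empty: "N v = {}" if "v \<notin> pverts G" for v using that unfolding N_def using in_arcsD1 by blast
  interpret short_cycle_graph "pverts G" N
  proof
    show "finite (pverts G)" by simp
    show "N v \<subseteq> pverts G" for v by (rule N_sub)
    show "v \<in> N w" if "w \<in> N v" for v w using that arcs_symmetric unfolding N_def by blast
    show "v \<notin> N v" for v using no_loops' unfolding N_def by blast
    show "card (N v) \<le> 3" for v
      using assms(2) empty[of v] deg unfolding subcubic_def by (cases "v \<in> pverts G") auto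
    fix v assume v: "card (N v) = 3"
    then have vV: "v \<in> pverts G" using empty[of v] by fastforce
    show "a = b" if "a \<in> N v" "b \<in> N v" "card (N a) = 3" "card (N b) = 3" for a b
    proof -
      have "card {w. (v, w) \<in> parcs G \<and> degree G w = 3} \<le> 1"
        using assms(3) vV v deg unfolding saturated_def by simp
      moreover have "finite {w. (v, w) \<in> parcs G \<and> degree G w = 3}"
        by (rule finite_subset[of _ "pverts G"]) (use in_arcsD2 in auto)
      moreover have "a \<in> {w. (v, w) \<in> parcs G \<and> degree G w = 3}"
        "b \<in> {w. (v, w) \<in> parcs G \<and> degree G w = 3}" using that deg unfolding N_def by auto
      ultimately show "a = b" by (metis (no_types, lifting) One_nat_def card_le_Suc0_iff_eq)
    qed
    have "local_girth G v \<le> g3 G" unfolding g3_def using vV v deg by (intro SUP_upper) simp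
    then have "local_girth G v \<le> 4" using assms(4) by simp
    then show "\<exists>a b. a \<in> N v \<and> b \<in> N v \<and> a \<noteq> b \<and> (b \<in> N a \<or> (\<exists>w. w \<noteq> v \<and> w \<in> N a \<and> w \<in> N b))"
      using local_girth_le_4[of v] unfolding N_def by blast
  qed
  obtain c :: "'a \<Rightarrow> nat" where c: "\<And>v. c v < 4"
    "\<And>u v. u \<in> pverts G \<Longrightarrow> v \<in> N u \<Longrightarrow> c u \<noteq> c v"
    "\<And>u v n. u \<in> pverts G \<Longrightarrow> u \<noteq> v \<Longrightarrow> n \<in> N u \<Longrightarrow> v \<in> N n \<Longrightarrow> c u = c v \<Longrightarrow> c u = 0"
    by (rule ex_coloring) blast
  define V where "V i = {v \<in> pverts G. c v = i}" for i
  have "gdist G u v > ereal (real ([1, 2, 2, 2] ! i))"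
    if i: "i < 4" and uv: "u \<in> V i" "v \<in> V i" "u \<noteq> v" for i u v
  proof (cases "i = 0")
    case True
    have "(u, v) \<notin> parcs G" using c(2)[of u v] uv unfolding V_def N_def by auto
    then show ?thesis using gdist_gt_1 uv True by simp
  next
    case False
    have "(u, v) \<notin> parcs G" using c(2)[of u v] uv unfolding V_def N_def by auto
    moreover have "(n, v) \<notin> parcs G" if "(u, n) \<in> parcs G" for n
      using c(3)[of u v n] uv that False unfolding V_def N_def by auto
    ultimately have "gdist G u v > ereal 2" using gdist_gt_2 uv by blast
    moreover have "[1, 2, 2, 2] ! i = (2 :: nat)"
      using i False by (auto simp: eval_nat_numeral less_Suc_eq)
    ultimately show ?thesis by simp
  qed
  then have "packing_coloring G [1, 2, 2, 2] V"
    unfolding packing_coloring_def disjoint_family_on_def using c(1) by (auto simp: V_def eval_nat_numeral)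
  then show ?thesis unfolding packing_colorable_def by blast
qed

end
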